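(* Let $A,B\in\mathcal{M}_n$ be positive definite matrices and let $0\le t\le1$. Then $$\hat{T}_{\frac12}(A|B)\le t\,\hat{T}_t(A|B)+(1-t)\,\hat{T}_{1-t}(A|B)\le\hat{T}_1(A|B),$$ where for $t=0$ (respectively $t=1$) the term $t\,\hat{T}_t(A|B)$ (respectively $(1-t)\hat{T}_{1-t}(A|B)$) is read as $O$.
   Context: $\mathcal{M}_n$ is the algebra of $n\times n$ complex matrices; $X\le Y$ for Hermitian matrices means $Y-X$ is positive semidefinite, and $O$ is the zero matrix. For positive definite $A,B$ and $0\le t\le1$: $A\natural_t B:=A^{\frac12}\left(B^{\frac12}A^{-1}B^{\frac12}\right)^{t}A^{\frac12}$. The quasi-Tsallis relative operator entropy is $\hat{T}_t(A|B):=\dfrac{A\natural_tB-A}{t}$ for $0<t\le1$. *)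

theory Defs
  imports
    Complex_Main
    "Jordan_Normal_Form.Schur_Decomposition"
    "Jordan_Normal_Form.Gauss_Jordan_Elimination"
begin

definition hermitian :: "complex mat \<Rightarrow> bool"
  where "hermitian A \<longleftrightarrow> mat_adjoint A = A"

definition positive_semidefinite :: "nat \<Rightarrow> complex mat \<Rightarrow> bool"
  where "positive_semidefinite n A \<longleftrightarrow>
    A \<in> carrier_mat n n \<and> hermitian A \<and>
    (\<forall>v \<in> carrier_vec n. 0 \<le> Re ((A *\<^sub>v v) \<bullet>c v))"

definition positive_definite :: "nat \<Rightarrow> complex mat \<Rightarrow> bool"
  where "positive_definite n A \<longleftrightarrow>
    A \<in> carrier_mat n n \<and> hermitian A \<and>
    (\<forall>v \<in> carrier_vec n. v \<noteq> 0\<^sub>v n \<longrightarrow> 0 < Re ((A *\<^sub>v v) \<bullet>c v))"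

definition loewner_le :: "nat \<Rightarrow> complex mat \<Rightarrow> complex mat \<Rightarrow> bool"
  where "loewner_le n X Y \<longleftrightarrow>
    X \<in> carrier_mat n n \<and> Y \<in> carrier_mat n n \<and> hermitian X \<and> hermitian Y \<and>
    positive_semidefinite n (Y - X)"

definition unitary :: "nat \<Rightarrow> complex mat \<Rightarrow> bool"
  where "unitary n U \<longleftrightarrow>
    U \<in> carrier_mat n n \<and> U * mat_adjoint U = 1\<^sub>m n \<and> mat_adjoint U * U = 1\<^sub>m n"

definition unitary_diag :: "nat \<Rightarrow> complex mat \<Rightarrow> (nat \<Rightarrow> real) \<Rightarrow> complex mat"
  where "unitary_diag n U d = U * mat_diag n (\<lambda>i. complex_of_real (d i)) * mat_adjoint U"

text \<open>Real powers of a positive definite matrix by spectral calculus: if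
  \<open>X = U diag(d) U*\<close> with \<open>U\<close> unitary, then \<open>X\<^sup>t = U diag(d\<^sup>t) U*\<close>. One unitary
  diagonalisation is chosen; \<open>mat_powr_eq\<close> below shows that the choice is irrelevant.
  The value is unspecified if \<open>X\<close> is not Hermitian, and only meant for positive
  eigenvalues (\<open>powr\<close>).\<close>

definition mat_powr :: "complex mat \<Rightarrow> real \<Rightarrow> complex mat"
  where "mat_powr X t =
    (let n = dim_row X;
         (U, d) = (SOME (U, d). unitary n U \<and> X = unitary_diag n U d)
     in unitary_diag n U (\<lambda>i. d i powr t))"

lemma adjoint_carrier:
  "A \<in> carrier_mat n n \<Longrightarrow> mat_adjoint A \<in> carrier_mat n n"
  unfolding mat_adjoint_def by auto

lemma unitary_diag_fun_unique:
  assumes U: "unitary n U" and V: "unitary n V"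
    and eq: "unitary_diag n U d = unitary_diag n V e"
  shows "unitary_diag n U (\<lambda>i. f (d i)) = unitary_diag n V (\<lambda>i. f (e i))"
proof -
  let ?D = "\<lambda>d. mat_diag n (\<lambda>i. complex_of_real (d i))"
  let ?U = "mat_adjoint U" and ?V = "mat_adjoint V"
  have c [simp]: "U \<in> carrier_mat n n" "V \<in> carrier_mat n n"
    "?U \<in> carrier_mat n n" "?V \<in> carrier_mat n n"
    using U V by (auto simp: unitary_def intro: adjoint_carrier)
  have u: "U * ?U = 1\<^sub>m n" "?U * U = 1\<^sub>m n" "V * ?V = 1\<^sub>m n" "?V * V = 1\<^sub>m n"
    using U V by (auto simp: unitary_def)
  note mc [intro!] = mult_carrier_mat[of _ n n _ n]
  note am = assoc_mult_mat[of _ n n _ n _ n]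
  define W where "W = ?V * U"
  have W [simp]: "W \<in> carrier_mat n n" unfolding W_def by (rule mult_carrier_mat[of _ n n]) auto
  have left: "?V * unitary_diag n U g * U = W * ?D g" for g
  proof -
    have "?V * unitary_diag n U g * U = ?V * (U * ?D g * ?U * U)"
      unfolding unitary_diag_def by (rule am) auto
    also have "U * ?D g * ?U * U = U * ?D g * (?U * U)"
      by (rule am) auto
    also have "\<dots> = U * ?D g" unfolding u by (rule right_mult_one_mat[of _ n n]) auto
    also have "?V * (U * ?D g) = W * ?D g" unfolding W_def
      by (rule am[symmetric]) auto
    finally show ?thesis .
  qed
  have right: "?V * unitary_diag n V g * U = ?D g * W" for g
  proof -
    have "?V * unitary_diag n V g = ?V * (V * (?D g * ?V))"
      unfolding unitary_diag_def
      by (rule arg_cong[of _ _ "\<lambda>x. ?V * x"]) (rule am, auto)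
    also have "\<dots> = ?V * V * (?D g * ?V)"
      by (rule am[symmetric]) auto
    also have "\<dots> = ?D g * ?V" unfolding u by (rule left_mult_one_mat[of _ n n]) auto
    finally have "?V * unitary_diag n V g * U = ?D g * ?V * U" by simp
    also have "\<dots> = ?D g * W" unfolding W_def by (rule am) auto
    finally show ?thesis .
  qed
  have comm: "W * ?D d = ?D e * W" using left[of d] right[of e] eq by simp
  have entry: "W $$ (i,j) * complex_of_real (d j) = complex_of_real (e i) * W $$ (i,j)"
    if "i < n" "j < n" for i j
    using arg_cong[OF comm, of "\<lambda>M. M $$ (i,j)"] that
    by (simp add: mat_diag_mult_left[OF W] mat_diag_mult_right[OF W])
  have "W * ?D (\<lambda>i. f (d i)) = ?D (\<lambda>i. f (e i)) * W"
    unfolding mat_diag_mult_left[OF W] mat_diag_mult_right[OF W]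
  proof (rule eq_matI, goal_cases)
    case (1 i j)
    then have ij: "i < n" "j < n" by auto
    show ?case
    proof (cases "W $$ (i,j) = 0")
      case False
      then have "d j = e i" using entry[OF ij] by (simp add: mult.commute)
      then show ?thesis using ij by simp
    qed (use ij in simp)
  qed auto
  then have key: "?V * unitary_diag n U (\<lambda>i. f (d i)) * U =
      ?V * unitary_diag n V (\<lambda>i. f (e i)) * U"
    using left[of "\<lambda>i. f (d i)"] right[of "\<lambda>i. f (e i)"] by simp
  have cancel: "V * (?V * X * U) * ?U = X" if X: "X \<in> carrier_mat n n" for X
  proof -
    have "V * (?V * X * U) = V * (?V * (X * U))"
      by (rule arg_cong[of _ _ "\<lambda>x. V * x"]) (rule am, use X in auto)
    also have "\<dots> = V * ?V * (X * U)" by (rule am[symmetric]) (use X in auto)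
    also have "\<dots> = X * U" unfolding u
      by (rule left_mult_one_mat[of _ n n]) (rule mult_carrier_mat[OF X c(1)])
    finally have "V * (?V * X * U) * ?U = X * U * ?U" by simp
    also have "\<dots> = X * (U * ?U)" by (rule am) (use X in auto)
    also have "\<dots> = X" unfolding u by (rule right_mult_one_mat[OF X])
    finally show ?thesis .
  qed
  have carr: "unitary_diag n U g \<in> carrier_mat n n" "unitary_diag n V g \<in> carrier_mat n n" for g
    unfolding unitary_diag_def by (auto intro!: mult_carrier_mat[of _ n n])
  show ?thesis
    using arg_cong[OF key, of "\<lambda>M. V * M * ?U"] cancel[OF carr(1)] cancel[OF carr(2)] by simp
qed

lemma mat_powr_eq:
  assumes U: "unitary n U" and X: "X = unitary_diag n U d"
  shows "mat_powr X t = unitary_diag n U (\<lambda>i. d i powr t)"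
proof -
  have n: "dim_row X = n" using U X by (auto simp: unitary_def unitary_diag_def)
  obtain V e where Ve: "(SOME (U, d). unitary n U \<and> X = unitary_diag n U d) = (V, e)"
    by force
  have "case (SOME (U, d). unitary n U \<and> X = unitary_diag n U d) of
      (U, d) \<Rightarrow> unitary n U \<and> X = unitary_diag n U d"
    by (rule someI[of _ "(U, d)"]) (use U X in auto)
  then have V: "unitary n V" "X = unitary_diag n V e" unfolding Ve by auto
  have "mat_powr X t = unitary_diag n V (\<lambda>i. e i powr t)"
    unfolding mat_powr_def n Let_def Ve by simp
  also have "\<dots> = unitary_diag n U (\<lambda>i. d i powr t)"
    using unitary_diag_fun_unique[OF U V(1), of d e "\<lambda>x. x powr t"] X V(2) by simp
  finally show ?thesis .
qed

text \<open>The \<open>t\<close>-weighted mean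
  \<open>A\<^sup>1\<^sup>/\<^sup>2 (B\<^sup>1\<^sup>/\<^sup>2 A\<^sup>-\<^sup>1 B\<^sup>1\<^sup>/\<^sup>2)\<^sup>t A\<^sup>1\<^sup>/\<^sup>2\<close>. The outer factors are powers of \<open>A\<close> and
  the inner ones of \<open>B\<close>, so this is not the weighted geometric mean. \<open>mat_inverse\<close> is
  option-valued; it is \<open>Some\<close> for every positive definite \<open>A\<close>.\<close>

definition natural_mean :: "real \<Rightarrow> complex mat \<Rightarrow> complex mat \<Rightarrow> complex mat"
  where "natural_mean t A B =
    mat_powr A (1/2) *
    mat_powr (mat_powr B (1/2) * the (mat_inverse A) * mat_powr B (1/2)) t *
    mat_powr A (1/2)"

text \<open>Meant for \<open>0 < t \<le> 1\<close>.\<close>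

definition quasi_tsallis :: "real \<Rightarrow> complex mat \<Rightarrow> complex mat \<Rightarrow> complex mat"
  where "quasi_tsallis t A B = complex_of_real (1 / t) \<cdot>\<^sub>m (natural_mean t A B - A)"

end

theory Submission
  imports Defs "Jordan_Normal_Form.Spectral_Radius"
begin

text \<open>Diagonalise the positive definite matrix
  \<open>B\<^sup>1\<^sup>/\<^sup>2 A\<^sup>-\<^sup>1 B\<^sup>1\<^sup>/\<^sup>2 = U diag(d) U*\<close> and put \<open>W = A\<^sup>1\<^sup>/\<^sup>2 U\<close>. The mean with parameter \<open>s\<close> is then
  \<open>W diag(d\<^sup>s) W*\<close> and \<open>A = W W*\<close>, so all three members of the inequality have the form
  \<open>W diag(f(d)) W*\<close> with the same \<open>W\<close>. Such matrices are ordered as soon as the scalar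
  functions \<open>f\<close> are, which leaves
  \<open>2 x\<^sup>1\<^sup>/\<^sup>2 \<le> x\<^sup>t + x\<^sup>1\<^sup>-\<^sup>t \<le> x + 1\<close> for \<open>x > 0\<close>: the left side is the arithmetic-geometric mean
  inequality, the right side is \<open>(1 - x\<^sup>t) (1 - x\<^sup>1\<^sup>-\<^sup>t) \<ge> 0\<close>.\<close>

section \<open>Adjoints and quadratic forms\<close>

lemma mat_adjoint_dim [simp]:
  "dim_row (mat_adjoint A) = dim_col A" "dim_col (mat_adjoint A) = dim_row A"
  unfolding mat_adjoint_def by auto

lemma mat_adjoint_carrier [simp]:
  "A \<in> carrier_mat m n \<Longrightarrow> mat_adjoint A \<in> carrier_mat n m"
  by auto

lemma mat_adjoint_index [simp]:
  fixes A :: "complex mat"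
  assumes "i < dim_col A" "j < dim_row A"
  shows "mat_adjoint A $$ (i, j) = cnj (A $$ (j, i))"
  using assms unfolding mat_adjoint_def by (simp add: mat_of_rows_index)

lemma mat_adjoint_adjoint [simp]: "mat_adjoint (mat_adjoint A) = (A :: complex mat)"
  by (rule eq_matI) auto

lemma mat_adjoint_mult:
  fixes A B :: "complex mat"
  assumes "A \<in> carrier_mat l m" "B \<in> carrier_mat m n"
  shows "mat_adjoint (A * B) = mat_adjoint B * mat_adjoint A"
  using assms by (intro eq_matI) (auto simp: scalar_prod_def mult.commute)

lemma mat_adjoint_mult3:
  fixes A B C :: "complex mat"
  assumes "A \<in> carrier_mat n n" "B \<in> carrier_mat n n" "C \<in> carrier_mat n n"
  shows "mat_adjoint (A * B * C) = mat_adjoint C * mat_adjoint B * mat_adjoint A"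
proof -
  have "mat_adjoint (A * B * C) = mat_adjoint C * (mat_adjoint B * mat_adjoint A)"
    using assms by (simp add: mat_adjoint_mult[of _ n n _ n] mult_carrier_mat[of _ n n _ n] del: assoc_mult_mat)
  also have "\<dots> = mat_adjoint C * mat_adjoint B * mat_adjoint A"
    using assms by (intro assoc_mult_mat[symmetric, of _ n n _ n _ n]) auto
  finally show ?thesis .
qed

lemma cscalar_prod_adjoint:
  fixes C :: "complex mat"
  assumes "C \<in> carrier_mat m n" "x \<in> carrier_vec n" "y \<in> carrier_vec m"
  shows "(C *\<^sub>v x) \<bullet>c y = x \<bullet>c (mat_adjoint C *\<^sub>v y)"
proof -
  have "(C *\<^sub>v x) \<bullet>c y = (\<Sum>i<m. \<Sum>j<n. C $$ (i,j) * x $ j * cnj (y $ i))"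
    using assms by (auto simp: scalar_prod_def sum_distrib_right lessThan_atLeast0 intro!: sum.cong)
  also have "\<dots> = (\<Sum>j<n. \<Sum>i<m. C $$ (i,j) * x $ j * cnj (y $ i))"
    by (rule sum.swap)
  also have "\<dots> = x \<bullet>c (mat_adjoint C *\<^sub>v y)"
    using assms by (auto simp: scalar_prod_def sum_distrib_left lessThan_atLeast0 ac_simps intro!: sum.cong)
  finally show ?thesis .
qed

lemma cscalar_prod_congruence:
  fixes C P :: "complex mat"
  assumes C: "C \<in> carrier_mat n n" and P: "P \<in> carrier_mat n n" and v: "v \<in> carrier_vec n"
  shows "((C * P * mat_adjoint C) *\<^sub>v v) \<bullet>c v =
    (P *\<^sub>v (mat_adjoint C *\<^sub>v v)) \<bullet>c (mat_adjoint C *\<^sub>v v)"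
proof -
  have "(C * P * mat_adjoint C) *\<^sub>v v = C *\<^sub>v (P *\<^sub>v (mat_adjoint C *\<^sub>v v))"
    using assms by (simp add: assoc_mult_mat_vec[of _ n n _ n] mult_carrier_mat[of _ n n _ n]
        mult_mat_vec_carrier[of _ n n])
  then show ?thesis
    using assms by (simp add: cscalar_prod_adjoint[of C n n] mult_mat_vec_carrier[of _ n n])
qed

text \<open>The quadratic form at \<open>v\<close> is that of \<open>P\<close> at
  \<open>mat_adjoint C *\<^sub>v v\<close>, and the left inverse \<open>D\<close> of
  \<open>mat_adjoint C\<close> keeps this vector nonzero.\<close>

lemma positive_definite_congruence:
  assumes P: "positive_definite n P" and C: "C \<in> carrier_mat n n" and D: "D \<in> carrier_mat n n"
    and inv: "D * mat_adjoint C = 1\<^sub>m n"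
  shows "positive_definite n (C * P * mat_adjoint C)"
  unfolding positive_definite_def hermitian_def
proof (intro conjI ballI impI)
  have Pc [simp]: "P \<in> carrier_mat n n" and Ph: "mat_adjoint P = P"
    using P by (auto simp: positive_definite_def hermitian_def)
  note C [simp] D [simp]
  show "C * P * mat_adjoint C \<in> carrier_mat n n" by (intro mult_carrier_mat[of _ n n]) auto
  show "mat_adjoint (C * P * mat_adjoint C) = C * P * mat_adjoint C"
    by (subst mat_adjoint_mult3[of _ n]) (simp_all add: Ph)
  fix v :: "complex vec" assume v: "v \<in> carrier_vec n" "v \<noteq> 0\<^sub>v n"
  have "mat_adjoint C *\<^sub>v v \<noteq> 0\<^sub>v n"
  proof
    assume 0: "mat_adjoint C *\<^sub>v v = 0\<^sub>v n"
    have "v = (D * mat_adjoint C) *\<^sub>v v" using v by (simp add: inv)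
    also have "\<dots> = D *\<^sub>v (mat_adjoint C *\<^sub>v v)"
      using v by (intro assoc_mult_mat_vec[of _ n n _ n]) auto
    also have "\<dots> = 0\<^sub>v n" unfolding 0 using carrier_matD[OF D]
      by (intro eq_vecI) (auto simp: scalar_prod_def simp del: D)
    finally show False using v by simp
  qed
  then show "0 < Re (((C * P * mat_adjoint C) *\<^sub>v v) \<bullet>c v)"
    using P mult_mat_vec_carrier[OF mat_adjoint_carrier[OF C] v(1)]
    unfolding cscalar_prod_congruence[OF C Pc v(1)] positive_definite_def by blast
qed

section \<open>Congruences of diagonal matrices\<close>

text \<open>Despite its name, \<open>unitary_diag n W f\<close> is used for arbitrary square \<open>W\<close>;
  only the lemmas that assume \<open>unitary\<close> rely on the functional calculus.\<close>

lemma unitary_diag_carrier [simp]: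
  "W \<in> carrier_mat n n \<Longrightarrow> unitary_diag n W f \<in> carrier_mat n n"
  unfolding unitary_diag_def by (intro mult_carrier_mat[of _ n n]) auto

lemma unitary_diag_dim [simp]:
  assumes "W \<in> carrier_mat n n"
  shows "dim_row (unitary_diag n W f) = n" "dim_col (unitary_diag n W f) = n"
  using unitary_diag_carrier[OF assms, of f] by auto

text \<open>The entries are linear in \<open>f\<close>, so the additive rules that follow reduce to
  identities between finite sums.\<close>

lemma unitary_diag_index:
  assumes W: "W \<in> carrier_mat n n" and "i < n" "j < n"
  shows "unitary_diag n W f $$ (i, j) = (\<Sum>k<n. complex_of_real (f k) * (W $$ (i,k) * cnj (W $$ (j,k))))"
  using assms unfolding unitary_diag_def mat_diag_mult_right[OF W]
  by (auto simp: scalar_prod_def lessThan_atLeast0 ac_simps intro!: sum.cong)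

lemma unitary_diag_cong:
  assumes "W \<in> carrier_mat n n" "\<And>i. i < n \<Longrightarrow> f i = g i"
  shows "unitary_diag n W f = unitary_diag n W g"
  using assms by (intro eq_matI) (auto simp: unitary_diag_index)

lemma unitary_diag_add:
  "W \<in> carrier_mat n n \<Longrightarrow>
    unitary_diag n W f + unitary_diag n W g = unitary_diag n W (\<lambda>i. f i + g i)"
  by (intro eq_matI) (auto simp: unitary_diag_index distrib_right sum.distrib)

lemma unitary_diag_diff:
  "W \<in> carrier_mat n n \<Longrightarrow>
    unitary_diag n W f - unitary_diag n W g = unitary_diag n W (\<lambda>i. f i - g i)"
  by (intro eq_matI) (auto simp: unitary_diag_index left_diff_distrib sum_subtractf)

lemma unitary_diag_smult:
  "W \<in> carrier_mat n n \<Longrightarrow>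
    complex_of_real c \<cdot>\<^sub>m unitary_diag n W f = unitary_diag n W (\<lambda>i. c * f i)"
  by (intro eq_matI) (auto simp: unitary_diag_index sum_distrib_left mult.assoc)

lemma unitary_diag_zero: "W \<in> carrier_mat n n \<Longrightarrow> unitary_diag n W (\<lambda>i. 0) = 0\<^sub>m n n"
  by (intro eq_matI) (auto simp: unitary_diag_index)

lemma unitary_diag_one: "unitary n U \<Longrightarrow> unitary_diag n U (\<lambda>i. 1) = 1\<^sub>m n"
  by (auto simp: unitary_diag_def unitary_def)

lemma hermitian_unitary_diag: "W \<in> carrier_mat n n \<Longrightarrow> hermitian (unitary_diag n W f)"
  unfolding hermitian_def
  by (intro eq_matI) (auto simp: unitary_diag_index mult.commute)

text \<open>The inner factor \<open>mat_adjoint U * U\<close> cancels, so only the two commuting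
  diagonal matrices are multiplied.\<close>

lemma unitary_diag_mult:
  assumes U: "unitary n U"
  shows "unitary_diag n U f * unitary_diag n U g = unitary_diag n U (\<lambda>i. f i * g i)"
proof -
  let ?D = "\<lambda>d. mat_diag n (\<lambda>i. complex_of_real (d i))"
  have c [simp]: "U \<in> carrier_mat n n" and u: "mat_adjoint U * U = 1\<^sub>m n"
    using U by (auto simp: unitary_def)
  note am = assoc_mult_mat[of _ n n _ n _ n]
  have "unitary_diag n U f * unitary_diag n U g =
      U * (?D f * ((mat_adjoint U * U) * (?D g * mat_adjoint U)))"
    unfolding unitary_diag_def by (simp add: am mult_carrier_mat[of _ n n _ n])
  also have "\<dots> = U * (?D f * (?D g * mat_adjoint U))"
    unfolding u by (simp add: mult_carrier_mat[of _ n n _ n] left_mult_one_mat[of _ n n])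
  also have "\<dots> = U * (?D f * ?D g * mat_adjoint U)"
    by (simp add: am mult_carrier_mat[of _ n n _ n] del: mat_diag_diag)
  also have "\<dots> = unitary_diag n U (\<lambda>i. f i * g i)"
    unfolding unitary_diag_def by (simp add: am mult_carrier_mat[of _ n n _ n])
  finally show ?thesis .
qed

text \<open>This absorbs the outer factors of the mean into \<open>W\<close> and, in the spectral
  theorem, composes two changes of basis.\<close>

lemma unitary_diag_congruence:
  assumes C [simp]: "C \<in> carrier_mat n n" and W [simp]: "W \<in> carrier_mat n n"
  shows "C * unitary_diag n W f * mat_adjoint C = unitary_diag n (C * W) f"
  unfolding unitary_diag_def
  by (simp add: mat_adjoint_mult[of C n n W n] assoc_mult_mat[of _ n n _ n _ n]
      mult_carrier_mat[of _ n n _ n])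

lemma cscalar_prod_mat_diag:
  assumes "v \<in> carrier_vec n"
  shows "(mat_diag n (\<lambda>i. complex_of_real (f i)) *\<^sub>v v) \<bullet>c v =
    complex_of_real (\<Sum>i<n. f i * (cmod (v $ i))\<^sup>2)"
proof -
  have "mat_diag n (\<lambda>i. complex_of_real (f i)) *\<^sub>v v = vec n (\<lambda>i. f i * v $ i)"
  proof (rule eq_vecI)
    fix i assume i: "i < dim_vec (vec n (\<lambda>i. f i * v $ i))"
    have "(\<Sum>j<n. (if i = j then complex_of_real (f j) else 0) * v $ j) =
        (\<Sum>j<n. if i = j then f j * v $ j else 0)"
      by (rule sum.cong) auto
    then show "(mat_diag n (\<lambda>i. complex_of_real (f i)) *\<^sub>v v) $ i = vec n (\<lambda>i. f i * v $ i) $ i"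
      using i assms by (simp add: mat_diag_def scalar_prod_def lessThan_atLeast0)
  qed (simp add: mat_diag_def)
  then show ?thesis
    using assms
    by (simp add: scalar_prod_def lessThan_atLeast0 mult.assoc complex_norm_square[symmetric]
      del: of_real_power)
qed

lemma cscalar_prod_unitary_diag:
  assumes W: "W \<in> carrier_mat n n" and v: "v \<in> carrier_vec n"
  shows "Re ((unitary_diag n W f *\<^sub>v v) \<bullet>c v) = (\<Sum>i<n. f i * (cmod ((mat_adjoint W *\<^sub>v v) $ i))\<^sup>2)"
  unfolding unitary_diag_def using W v
  by (simp add: cscalar_prod_congruence cscalar_prod_mat_diag[OF mult_mat_vec_carrier[of _ n n]])

text \<open>The difference is again of this form, and its quadratic form at \<open>v\<close> is the
  sum of \<open>g i - f i\<close> weighted by the squared moduli of the coordinates of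
  \<open>mat_adjoint W *\<^sub>v v\<close>.\<close>

lemma loewner_le_unitary_diag:
  assumes W: "W \<in> carrier_mat n n" and le: "\<And>i. i < n \<Longrightarrow> f i \<le> g i"
  shows "loewner_le n (unitary_diag n W f) (unitary_diag n W g)"
  unfolding loewner_le_def positive_semidefinite_def
  using W le
  by (auto simp: hermitian_unitary_diag unitary_diag_diff cscalar_prod_unitary_diag intro!: sum_nonneg)

lemma positive_definite_mat_diag:
  assumes "\<And>i. i < n \<Longrightarrow> 0 < d i"
  shows "positive_definite n (mat_diag n (\<lambda>i. complex_of_real (d i)))"
  unfolding positive_definite_def hermitian_def
proof (intro conjI ballI impI)
  show "mat_adjoint (mat_diag n (\<lambda>i. complex_of_real (d i))) = mat_diag n (\<lambda>i. complex_of_real (d i))"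
    by (intro eq_matI) (auto simp: mat_diag_def)
  fix v :: "complex vec" assume v: "v \<in> carrier_vec n" "v \<noteq> 0\<^sub>v n"
  \<comment> \<open>A nonzero coordinate supplies the one strictly positive summand.\<close>
  then obtain k where "k < n" "v $ k \<noteq> 0" by (metis carrier_vecD eq_vecI index_zero_vec)
  then have "0 < (\<Sum>i<n. d i * (cmod (v $ i))\<^sup>2)"
    using assms by (intro sum_pos2[of _ k]) (auto intro!: mult_nonneg_nonneg intro: less_imp_le)
  then show "0 < Re ((mat_diag n (\<lambda>i. complex_of_real (d i)) *\<^sub>v v) \<bullet>c v)"
    using v by (simp add: cscalar_prod_mat_diag)
qed simp

lemma positive_definite_unitary_diag:
  assumes "unitary n U" "\<And>i. i < n \<Longrightarrow> 0 < d i"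
  shows "positive_definite n (unitary_diag n U d)"
  unfolding unitary_diag_def using assms
  by (intro positive_definite_congruence[OF positive_definite_mat_diag, of n d U U]) (auto simp: unitary_def)

section \<open>The spectral theorem for Hermitian matrices\<close>

lemma unitary_mult:
  assumes U: "unitary n U" and V: "unitary n V"
  shows "unitary n (U * V)"
proof -
  have c: "U * V \<in> carrier_mat n n" and [simp]: "U \<in> carrier_mat n n" "V \<in> carrier_mat n n"
    using U V by (auto simp: unitary_def intro!: mult_carrier_mat[of _ n n])
  have "mat_adjoint (U * V) * (U * V) = mat_adjoint V * ((mat_adjoint U * U) * V)"
    by (simp add: mat_adjoint_mult[of U n n V n] assoc_mult_mat[of _ n n _ n _ n]
      mult_carrier_mat[of _ n n _ n])
  also have "\<dots> = 1\<^sub>m n" using U V by (simp add: unitary_def left_mult_one_mat[of V n n])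
  finally have "mat_adjoint (U * V) * (U * V) = 1\<^sub>m n" .
  then show ?thesis
    using c mat_mult_left_right_inverse[of "mat_adjoint (U * V)" n "U * V"]
    by (simp add: unitary_def)
qed

text \<open>Complete \<open>v\<close> to a basis, orthogonalise by Gram-Schmidt, which leaves the
  first vector unchanged, and normalise the columns.\<close>

lemma unitary_with_first_column:
  assumes v: "(v :: complex vec) \<in> carrier_vec (Suc m)" and v0: "v \<noteq> 0\<^sub>v (Suc m)"
  obtains W c where "unitary (Suc m) W" "col W 0 = c \<cdot>\<^sub>v v"
proof -
  let ?n = "Suc m"
  interpret cof_vec_space ?n "TYPE(complex)" .
  define b where "b = basis_completion v"
  define ws where "ws = gram_schmidt ?n b"
  note bc = basis_completion[OF v v0, folded b_def]
  obtain vs where bv: "b = v # vs" using bc by (cases b) auto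
  have ws: "set ws \<subseteq> carrier_vec ?n" "corthogonal ws" "length ws = ?n"
    using gram_schmidt_result[OF bc(2,4,5) ws_def] bc(6) by auto
  have ws0: "ws ! 0 = v"
    using gram_schmidt_hd[OF v, of vs] ws(3) by (metis bv hd_conv_nth list.size(3) nat.distinct(1) ws_def)
  define r where "r j = complex_of_real (1 / sqrt (Re (ws ! j \<bullet>c ws ! j)))" for j
  have conj_r: "conjugate (r j) = r j" for j by (simp add: r_def)
  define W where "W = mat_of_cols ?n (map (\<lambda>j. r j \<cdot>\<^sub>v ws ! j) [0..<?n])"
  have wc: "ws ! j \<in> carrier_vec ?n" if "j < ?n" for j using ws that by auto
  have Wc [simp]: "W \<in> carrier_mat ?n ?n" unfolding W_def by (auto simp del: upt_Suc)
  have colW: "col W j = r j \<cdot>\<^sub>v ws ! j" if "j < ?n" for j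
    using that wc[OF that] unfolding W_def by (subst col_mat_of_cols) (auto simp del: upt_Suc)
  have "mat_adjoint W * W = 1\<^sub>m ?n"
  proof (rule eq_matI)
    fix i j assume "i < dim_row (1\<^sub>m ?n :: complex mat)" "j < dim_col (1\<^sub>m ?n :: complex mat)"
    then have ij: "i < ?n" "j < ?n" by auto
    have "(mat_adjoint W * W) $$ (i,j) = conjugate (col W i) \<bullet> col W j"
      using ij carrier_matD[OF Wc] by (auto simp: scalar_prod_def simp del: Wc)
    also have "\<dots> = r i * r j * (ws ! j \<bullet>c ws ! i)"
      using ij wc[OF ij(1)] wc[OF ij(2)]
      by (simp add: colW conj_r[simplified] conjugate_smult_vec conjugate_vec_sprod_comm[of "ws ! j" ?n "ws ! i"])
    also have "\<dots> = 1\<^sub>m ?n $$ (i,j)"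
    proof (cases "i = j")
      case True
      \<comment> \<open>The order on complex numbers forces the imaginary part to be zero, and
        \<open>corthogonal\<close> also excludes zero vectors. The squared norm is thus a positive
        real and \<open>r i\<close> is its inverse square root.\<close>
      have "ws ! i \<bullet>c ws ! i \<ge> 0" "ws ! i \<bullet>c ws ! i \<noteq> 0"
        using corthogonalD[OF ws(2), of i i] ij ws(3) by (auto intro: conjugate_square_ge_0_vec)
      then obtain x where x: "ws ! i \<bullet>c ws ! i = complex_of_real x" "x > 0"
        by (metis Im_complex_of_real Re_complex_of_real complex_is_Real_iff less_eq_complex_def
            of_real_0 of_real_Re order_le_less zero_complex.sel)
      then have "r i * r j * (ws ! j \<bullet>c ws ! i) = complex_of_real (x / (sqrt x * sqrt x))"
        unfolding True[symmetric] r_def x by (simp del: real_sqrt_mult_self)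
      then show ?thesis using x(2) True ij by simp
    next
      case False
      then show ?thesis using corthogonalD[OF ws(2), of j i] ij ws(3) by auto
    qed
    finally show "(mat_adjoint W * W) $$ (i,j) = 1\<^sub>m ?n $$ (i,j)" .
  qed (simp_all add: carrier_matD[OF Wc])
  \<comment> \<open>For square matrices a left inverse is also a right inverse.\<close>
  then have "unitary ?n W"
    using mat_mult_left_right_inverse[of "mat_adjoint W" ?n W] by (simp add: unitary_def)
  then show ?thesis using that[of W "r 0"] colW[of 0] ws0 by simp
qed

text \<open>Block form of the induction step of the spectral theorem: in the entry formula the
  summand \<open>k = 0\<close> splits off and gives the corner. The eigenvalue sequence
  \<open>case_nat a d\<close> is \<open>a, d 0, d 1, ...\<close>.\<close>

lemma unitary_diag_bordered:
  assumes V: "V \<in> carrier_mat m m"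
  shows "unitary_diag (Suc m) (four_block_mat (1\<^sub>m 1) (0\<^sub>m 1 m) (0\<^sub>m m 1) V) (case_nat a d) =
    four_block_mat (complex_of_real a \<cdot>\<^sub>m 1\<^sub>m 1) (0\<^sub>m 1 m) (0\<^sub>m m 1) (unitary_diag m V d)"
    (is "unitary_diag _ ?U _ = ?B")
proof (rule eq_matI)
  have U: "?U \<in> carrier_mat (Suc m) (Suc m)"
    using four_block_carrier_mat[of "1\<^sub>m 1 :: complex mat" 1 1 V m m] V by simp
  then show "dim_row (unitary_diag (Suc m) ?U (case_nat a d)) = dim_row ?B"
    "dim_col (unitary_diag (Suc m) ?U (case_nat a d)) = dim_col ?B"
    using V by auto
  fix i j assume "i < dim_row ?B" "j < dim_col ?B"
  then have "i < Suc m" "j < Suc m" using V by auto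
  then show "unitary_diag (Suc m) ?U (case_nat a d) $$ (i,j) = ?B $$ (i,j)"
    unfolding unitary_diag_index[OF U \<open>i < Suc m\<close> \<open>j < Suc m\<close>] using V
    by (cases i; cases j)
      (auto simp: unitary_diag_index[OF V] sum.lessThan_Suc_shift simp del: sum.lessThan_Suc)
qed

lemma unitary_bordered:
  assumes V: "unitary m V"
  shows "unitary (Suc m) (four_block_mat (1\<^sub>m 1) (0\<^sub>m 1 m) (0\<^sub>m m 1) V)" (is "unitary _ ?U")
proof -
  have Vc: "V \<in> carrier_mat m m" using V by (simp add: unitary_def)
  have U: "?U \<in> carrier_mat (Suc m) (Suc m)"
    using four_block_carrier_mat[of "1\<^sub>m 1 :: complex mat" 1 1 V m m] Vc by simp
  \<comment> \<open>Inserting the identity as a diagonal matrix of ones makes the block formula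
    applicable.\<close>
  have "?U * mat_adjoint ?U = unitary_diag (Suc m) ?U (case_nat 1 (\<lambda>i. 1))"
    unfolding unitary_diag_def nat.case_eq_if using right_mult_one_mat[OF U] by simp
  also have "\<dots> = 1\<^sub>m (Suc m)"
    unfolding unitary_diag_bordered[OF Vc] unitary_diag_one[OF V] by (intro eq_matI) auto
  finally show ?thesis
    using U mat_mult_left_right_inverse[of ?U "Suc m" "mat_adjoint ?U"] by (simp add: unitary_def)
qed

text \<open>Induction on the dimension by deflation: a unitary \<open>W\<close> with an eigenvector
  as first column turns \<open>A\<close> into a block diagonal matrix with a real corner and a
  Hermitian block of size \<open>m\<close>.\<close>

theorem hermitian_unitary_diagonalisation:
  assumes "A \<in> carrier_mat n n" "hermitian A"
  shows "\<exists>U d. unitary n U \<and> A = unitary_diag n U d"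
  using assms
proof (induction n arbitrary: A)
  case 0
  then have "unitary 0 (1\<^sub>m 0) \<and> A = unitary_diag 0 (1\<^sub>m 0) (\<lambda>i. 0)"
    by (auto simp: unitary_def unitary_diag_def intro!: eq_matI)
  then show ?case by blast
next
  case (Suc m)
  let ?n = "Suc m"
  note A [simp] = Suc.prems(1)
  obtain e v where ev: "eigenvector A v e"
    using spectrum_non_empty[OF A] by (auto simp: spectrum_def eigenvalue_def)
  then have v: "v \<in> carrier_vec ?n" "v \<noteq> 0\<^sub>v ?n" and Av: "A *\<^sub>v v = e \<cdot>\<^sub>v v"
    using A by (auto simp: eigenvector_def)
  obtain W c where W: "unitary ?n W" and W0: "col W 0 = c \<cdot>\<^sub>v v"
    using unitary_with_first_column[OF v] .
  have Wc [simp]: "W \<in> carrier_mat ?n ?n" using W by (simp add: unitary_def)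
  define A' where "A' = mat_adjoint W * A * W"
  have A'c [simp]: "A' \<in> carrier_mat ?n ?n"
    unfolding A'_def by (intro mult_carrier_mat[of _ ?n ?n]) auto
  have sym: "A' $$ (j,i) = cnj (A' $$ (i,j))" if "i < ?n" "j < ?n" for i j
  proof -
    have "mat_adjoint A' = A'"
      using Suc.prems(2) unfolding A'_def hermitian_def by (subst mat_adjoint_mult3[of _ ?n]) auto
    then show ?thesis using that A'c mat_adjoint_index[of j A' i] by (metis carrier_matD)
  qed
  \<comment> \<open>Since the first column of \<open>W\<close> is an eigenvector, the first column
    of \<open>A'\<close> is \<open>e\<close> times that of \<open>mat_adjoint W * W\<close>, the
    identity.\<close>
  have col0: "A' $$ (i,0) = (if i = 0 then e else 0)" if i: "i < ?n" for i
  proof -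
    have "A *\<^sub>v col W 0 = e \<cdot>\<^sub>v col W 0"
      using v A by (simp add: W0 mult_mat_vec[of _ ?n ?n] Av smult_smult_assoc mult.commute)
    then have "col (A * W) 0 = e \<cdot>\<^sub>v col W 0"
      by (subst col_mult2[of _ ?n ?n _ ?n]) auto
    moreover have "A' = mat_adjoint W * (A * W)"
      unfolding A'_def by (rule assoc_mult_mat[of _ ?n ?n _ ?n _ ?n]) auto
    then have "A' $$ (i,0) = row (mat_adjoint W) i \<bullet> col (A * W) 0"
      using i index_mult_mat(1)[of i "mat_adjoint W" 0 "A * W"] by (simp add: carrier_matD[OF Wc])
    ultimately have "A' $$ (i,0) = e * (row (mat_adjoint W) i \<bullet> col W 0)"
      using i by (simp add: scalar_prod_smult_distrib[of _ ?n] carrier_vecI)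
    also have "row (mat_adjoint W) i \<bullet> col W 0 = (mat_adjoint W * W) $$ (i,0)"
      using i carrier_matD[OF Wc] by (subst index_mult_mat) (simp_all del: Wc)
    finally show ?thesis using i W by (simp add: unitary_def)
  qed
  \<comment> \<open>The corner entry of a Hermitian matrix equals its own conjugate.\<close>
  have e: "e = complex_of_real (Re e)"
    using sym[of 0 0] col0[of 0] by (auto simp: complex_eq_iff)
  define A3 where "A3 = mat m m (\<lambda>(i,j). A' $$ (Suc i, Suc j))"
  have "hermitian A3" unfolding hermitian_def A3_def
    by (intro eq_matI) (auto intro!: sym[symmetric])
  then obtain V d where V: "unitary m V" and A3: "A3 = unitary_diag m V d"
    using Suc.IH[of A3] by (auto simp: A3_def)
  have Vc: "V \<in> carrier_mat m m" using V by (simp add: unitary_def)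
  let ?U = "four_block_mat (1\<^sub>m 1) (0\<^sub>m 1 m) (0\<^sub>m m 1) V"
  have U: "unitary ?n ?U" by (rule unitary_bordered[OF V])
  \<comment> \<open>The first row vanishes off the corner because it is the conjugate of the first
    column.\<close>
  have "A' = four_block_mat (complex_of_real (Re e) \<cdot>\<^sub>m 1\<^sub>m 1) (0\<^sub>m 1 m) (0\<^sub>m m 1) A3"
  proof (rule eq_matI, goal_cases)
    case (1 i j)
    then have ij: "i < ?n" "j < ?n" by (auto simp: A3_def)
    show ?case
      using ij e col0[of i] sym[of j 0] col0[of j]
      by (cases i; cases j) (auto simp: A3_def)
  qed (use A'c in \<open>auto simp: A3_def simp del: A'c\<close>)
  also have "\<dots> = unitary_diag ?n ?U (case_nat (Re e) d)"
    unfolding A3 unitary_diag_bordered[OF Vc] ..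
  finally have A': "A' = unitary_diag ?n ?U (case_nat (Re e) d)" .
  have "W * A' * mat_adjoint W = (W * mat_adjoint W) * A * (W * mat_adjoint W)"
    unfolding A'_def
    by (simp add: assoc_mult_mat[of _ ?n ?n _ ?n _ ?n] mult_carrier_mat[of _ ?n ?n _ ?n])
  also have "\<dots> = A"
    using W by (simp add: unitary_def left_mult_one_mat[OF A] right_mult_one_mat[OF A])
  finally have "A = unitary_diag ?n (W * ?U) (case_nat (Re e) d)"
    unfolding A' using unitary_diag_congruence[OF Wc, of ?U] U by (simp add: unitary_def)
  then show ?case using unitary_mult[OF W U] by blast
qed

text \<open>Each \<open>d i\<close> is the value of the quadratic form at the \<open>i\<close>-th
  column of \<open>U\<close>, which \<open>mat_adjoint U\<close> maps to a unit vector.\<close>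

lemma positive_definite_diagonalisation:
  assumes P: "positive_definite n P"
  obtains U d where "unitary n U" "P = unitary_diag n U d" "\<And>i. i < n \<Longrightarrow> 0 < d i"
proof -
  have Pc [simp]: "P \<in> carrier_mat n n" and "hermitian P"
    using P by (auto simp: positive_definite_def)
  then obtain U d where U: "unitary n U" and Pd: "P = unitary_diag n U d"
    using hermitian_unitary_diagonalisation by blast
  have Uc [simp]: "U \<in> carrier_mat n n" and u: "mat_adjoint U * U = 1\<^sub>m n" "U * mat_adjoint U = 1\<^sub>m n"
    using U by (auto simp: unitary_def)
  have "0 < d i" if i: "i < n" for i
  proof -
    define v where "v = col U i"
    have v: "v \<in> carrier_vec n" using i by (auto simp: v_def)
    have Uv: "mat_adjoint U *\<^sub>v v = unit_vec n i"
      using i u col_mult2[of "mat_adjoint U" n n U n i] by (simp add: v_def)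
    have "v \<noteq> 0\<^sub>v n"
    proof
      assume "v = 0\<^sub>v n"
      then have "(mat_adjoint U *\<^sub>v v) $ i = 0" using i carrier_matD[OF Uc] by simp
      then show False unfolding Uv using i by simp
    qed
    then have "0 < Re ((P *\<^sub>v v) \<bullet>c v)" using P v by (simp add: positive_definite_def)
    also have "\<dots> = (\<Sum>k<n. d k * (cmod (unit_vec n i $ k))\<^sup>2)"
      unfolding Pd by (simp add: cscalar_prod_unitary_diag v Uv)
    also have "\<dots> = (\<Sum>k<n. if k = i then d k else 0)"
      by (rule sum.cong) (auto simp: unit_vec_def)
    finally show ?thesis using i by simp
  qed
  then show ?thesis using that U Pd by blast
qed

section \<open>Real powers and the mean\<close>

text \<open>All four facts are scalar facts about \<open>powr\<close> on the positive eigenvalues of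
  a single diagonalisation.\<close>

lemma
  assumes P: "positive_definite n P"
  shows positive_definite_mat_powr: "positive_definite n (mat_powr P s)"
    and mat_powr_mult: "mat_powr P s * mat_powr P t = mat_powr P (s + t)"
    and mat_powr_0: "mat_powr P 0 = 1\<^sub>m n"
    and mat_powr_1: "mat_powr P 1 = P"
proof -
  obtain U d where U: "unitary n U" and Pd: "P = unitary_diag n U d" and d: "\<And>i. i < n \<Longrightarrow> 0 < d i"
    by (rule positive_definite_diagonalisation[OF P]) blast
  have Uc: "U \<in> carrier_mat n n" using U by (simp add: unitary_def)
  note pw = mat_powr_eq[OF U Pd]
  show "positive_definite n (mat_powr P s)"
    unfolding pw using d by (intro positive_definite_unitary_diag[OF U]) (metis less_irrefl powr_gt_zero)
  show "mat_powr P s * mat_powr P t = mat_powr P (s + t)"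
    unfolding pw unitary_diag_mult[OF U] by (simp add: powr_add)
  show "mat_powr P 0 = 1\<^sub>m n"
    \<comment> \<open>Positivity matters here: \<open>0 powr 0\<close> is \<open>0\<close>, not
      \<open>1\<close>.\<close>
    unfolding pw unitary_diag_one[OF U, symmetric] by (intro unitary_diag_cong[OF Uc]) (metis d less_irrefl powr_zero_eq_one)
  show "mat_powr P 1 = P"
    unfolding pw by (rule trans[OF _ Pd[symmetric]], intro unitary_diag_cong[OF Uc]) (use d in \<open>simp add: less_imp_le\<close>)
qed

text \<open>Rewriting the inverse as a power makes its positive definiteness an instance of the
  previous lemma.\<close>

lemma mat_inverse_positive_definite:
  assumes P: "positive_definite n P"
  shows "the (mat_inverse P) = mat_powr P (-1)"
proof -
  let ?Q = "mat_powr P (-1)"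
  have Pc: "P \<in> carrier_mat n n" and Qc: "?Q \<in> carrier_mat n n"
    using P positive_definite_mat_powr[OF P, of "-1"] by (auto simp: positive_definite_def)
  have PQ: "P * ?Q = 1\<^sub>m n" "?Q * P = 1\<^sub>m n"
    using mat_powr_mult[OF P, of 1 "-1"] mat_powr_mult[OF P, of "-1" 1]
    by (simp_all add: mat_powr_0[OF P] mat_powr_1[OF P])
  \<comment> \<open>Invertibility rules out the result \<open>None\<close>, so that
    \<open>the\<close> returns an actual inverse.\<close>
  then have "P \<in> Units (ring_mat TYPE(complex) n ())"
    using Pc Qc by (auto simp: Units_def ring_mat_def)
  then obtain R where R: "mat_inverse P = Some R"
    using mat_inverse(1)[OF Pc, of "()"] by (cases "mat_inverse P") auto
  then have "R * P = 1\<^sub>m n" "R \<in> carrier_mat n n" using mat_inverse(2)[OF Pc] by auto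
  then have "R = (R * P) * ?Q"
    unfolding assoc_mult_mat[OF \<open>R \<in> carrier_mat n n\<close> Pc Qc] PQ by simp
  then show ?thesis using R Qc \<open>R * P = 1\<^sub>m n\<close> by (simp add: left_mult_one_mat[of _ n n])
qed

text \<open>The parameter enters only as the exponent of the middle factor, so \<open>W\<close> and
  \<open>d\<close> are fixed before \<open>t\<close> and means with different parameters become
  comparable.\<close>

lemma natural_mean_simultaneous_form:
  assumes A: "positive_definite n A" and B: "positive_definite n B"
  obtains W d where "W \<in> carrier_mat n n" "\<And>i. i < n \<Longrightarrow> 0 < d i"
    "\<And>t. natural_mean t A B = unitary_diag n W (\<lambda>i. d i powr t)"
    "A = unitary_diag n W (\<lambda>i. 1)"
proof -
  define H where "H = mat_powr A (1/2)"
  define K where "K = mat_powr B (1/2)"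
  define X where "X = K * the (mat_inverse A) * K"
  have Hc [simp]: "H \<in> carrier_mat n n" and H: "mat_adjoint H = H"
    using positive_definite_mat_powr[OF A, of "1/2"]
    by (auto simp: H_def positive_definite_def hermitian_def)
  have Kc: "K \<in> carrier_mat n n" and K: "mat_adjoint K = K"
    using positive_definite_mat_powr[OF B, of "1/2"]
    by (auto simp: K_def positive_definite_def hermitian_def)
  have "mat_powr B (-1/2) \<in> carrier_mat n n"
    using positive_definite_mat_powr[OF B, of "-1/2"] by (auto simp: positive_definite_def)
  \<comment> \<open>The power \<open>-1/2\<close> of \<open>B\<close> is the left inverse required
    for the congruence by \<open>K\<close>.\<close>
  moreover have "mat_powr B (-1/2) * mat_adjoint K = 1\<^sub>m n"
    unfolding K unfolding K_def using mat_powr_mult[OF B, of "-1/2" "1/2"] by (simp add: mat_powr_0[OF B])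
  ultimately have "positive_definite n (K * mat_powr A (-1) * mat_adjoint K)"
    using Kc by (intro positive_definite_congruence[OF positive_definite_mat_powr[OF A]])
  then have "positive_definite n X"
    unfolding X_def mat_inverse_positive_definite[OF A] K .
  then obtain U d where U: "unitary n U" and X: "X = unitary_diag n U d" and d: "\<And>i. i < n \<Longrightarrow> 0 < d i"
    by (rule positive_definite_diagonalisation) blast
  have Uc [simp]: "U \<in> carrier_mat n n" using U by (simp add: unitary_def)
  have cong: "H * unitary_diag n U f * H = unitary_diag n (H * U) f" for f
    using unitary_diag_congruence[of H n U f] by (simp add: H)
  have "natural_mean t A B = unitary_diag n (H * U) (\<lambda>i. d i powr t)" for t
    unfolding natural_mean_def H_def[symmetric] K_def[symmetric] X_def[symmetric]
      mat_powr_eq[OF U X] cong ..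
  \<comment> \<open>With constant value \<open>1\<close> the middle factor is the identity, which
    leaves \<open>H * H\<close>.\<close>
  moreover have "A = unitary_diag n (H * U) (\<lambda>i. 1)"
    unfolding cong[symmetric] unitary_diag_one[OF U]
    using mat_powr_mult[OF A, of "1/2" "1/2"]
    by (simp add: mat_powr_1[OF A] right_mult_one_mat[OF Hc] flip: H_def)
  moreover have "H * U \<in> carrier_mat n n" by (rule mult_carrier_mat[OF Hc Uc])
  ultimately show ?thesis using that d by blast
qed

lemma powr_complementary_bounds:
  fixes x t :: real
  assumes x: "0 < x" and t: "0 \<le> t" "t \<le> 1"
  shows "2 * x powr (1/2) \<le> x powr t + x powr (1 - t)"
    and "x powr t + x powr (1 - t) \<le> x + 1"
proof -
  \<comment> \<open>The exponents are halved so that the cross term has exponent \<open>1/2\<close>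
    for every \<open>t\<close>.\<close>
  have "0 \<le> (x powr (t/2) - x powr ((1-t)/2))\<^sup>2" by simp
  also have "\<dots> = x powr t + x powr (1 - t) - 2 * x powr (1/2)"
  proof -
    have "x powr (t/2) * x powr (t/2) = x powr t"
      by (simp flip: powr_add)
    moreover have "x powr ((1-t)/2) * x powr ((1-t)/2) = x powr (1 - t)"
      unfolding powr_add[symmetric] by (rule arg_cong[of _ _ "\<lambda>e. x powr e"]) (simp add: field_simps)
    moreover have "x powr (t/2) * x powr ((1-t)/2) = x powr (1/2)"
      unfolding powr_add[symmetric] by (rule arg_cong[of _ _ "\<lambda>e. x powr e"]) (simp add: field_simps)
    ultimately show ?thesis by (simp only: power2_diff) (simp add: power2_eq_square mult.assoc)
  qed
  finally show "2 * x powr (1/2) \<le> x powr t + x powr (1 - t)" by simp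
  \<comment> \<open>Both exponents are nonnegative, so the two factors are both nonnegative for
    \<open>x \<le> 1\<close> and both nonpositive for \<open>x > 1\<close>. The product of the two
    powers is \<open>x\<close>.\<close>
  have "0 \<le> (1 - x powr t) * (1 - x powr (1 - t))"
  proof (cases "x \<le> 1")
    case True
    then show ?thesis using x t by (intro mult_nonneg_nonneg) (auto simp: powr_le1)
  next
    case False
    then show ?thesis using x t by (intro mult_nonpos_nonpos) (auto simp: ge_one_powr_ge_zero)
  qed
  also have "\<dots> = 1 + x - (x powr t + x powr (1 - t))"
    using x by (simp add: algebra_simps flip: powr_add)
  finally show "x powr t + x powr (1 - t) \<le> x + 1" by simp
qed

theorem theorem4p1:
  fixes n :: nat and A B :: "complex mat" and t :: real
  assumes "positive_definite n A" and "positive_definite n B"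
    and "0 \<le> t" and "t \<le> 1"
  shows "let M = (if t = 0 then 0\<^sub>m n n else complex_of_real t \<cdot>\<^sub>m quasi_tsallis t A B)
               + (if t = 1 then 0\<^sub>m n n else complex_of_real (1 - t) \<cdot>\<^sub>m quasi_tsallis (1 - t) A B)
         in loewner_le n (quasi_tsallis (1/2) A B) M \<and> loewner_le n M (quasi_tsallis 1 A B)"
proof -
  obtain W d where W: "W \<in> carrier_mat n n" and d: "\<And>i. i < n \<Longrightarrow> 0 < d i"
    and nm: "\<And>s. natural_mean s A B = unitary_diag n W (\<lambda>i. d i powr s)"
    and A: "A = unitary_diag n W (\<lambda>i. 1)"
    by (rule natural_mean_simultaneous_form[OF assms(1,2)]) blast
  \<comment> \<open>This holds even at \<open>s = 0\<close>, where \<open>1/0 = 0\<close> makes both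
    sides zero.\<close>
  have T: "quasi_tsallis s A B = unitary_diag n W (\<lambda>i. 1/s * (d i powr s - 1))" for s
    unfolding quasi_tsallis_def nm
    by (subst A) (simp add: unitary_diag_diff unitary_diag_smult W del: of_real_divide)
  \<comment> \<open>The factor \<open>s\<close> cancels \<open>1/s\<close>. At \<open>s = 0\<close>
    the function \<open>d i powr s - 1\<close> vanishes, in agreement with the convention for that
    term.\<close>
  have scaled: "(if s = 0 then 0\<^sub>m n n else complex_of_real s \<cdot>\<^sub>m quasi_tsallis s A B) =
      unitary_diag n W (\<lambda>i. d i powr s - 1)" for s
  proof (cases "s = 0")
    case True
    have "0\<^sub>m n n = unitary_diag n W (\<lambda>i. d i powr s - 1)"
      unfolding True unitary_diag_zero[OF W, symmetric] by (intro unitary_diag_cong[OF W]) (metis d diff_self less_irrefl powr_zero_eq_one)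
    then show ?thesis using True by simp
  qed (simp add: T unitary_diag_smult W)
  have M: "(if t = 0 then 0\<^sub>m n n else complex_of_real t \<cdot>\<^sub>m quasi_tsallis t A B)
      + (if t = 1 then 0\<^sub>m n n else complex_of_real (1 - t) \<cdot>\<^sub>m quasi_tsallis (1 - t) A B)
      = unitary_diag n W (\<lambda>i. (d i powr t - 1) + (d i powr (1 - t) - 1))" (is "?M = _")
    using scaled[of t] scaled[of "1 - t"] unitary_diag_add[OF W] by (auto split: if_splits)
  \<comment> \<open>Subtracting \<open>2\<close> from the scalar bounds gives
    \<open>2 * (x powr (1/2) - 1)\<close> on the left and \<open>x - 1\<close> on the right, the
    functions belonging to the parameters \<open>1/2\<close> and \<open>1\<close>.\<close>
  have "loewner_le n (quasi_tsallis (1/2) A B) ?M"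
    unfolding M unfolding T using d powr_complementary_bounds(1)[OF d assms(3,4)]
    by (intro loewner_le_unitary_diag[OF W]) (simp add: algebra_simps)
  moreover have "loewner_le n ?M (quasi_tsallis 1 A B)"
    unfolding M unfolding T using d powr_complementary_bounds(2)[OF d assms(3,4)]
    by (intro loewner_le_unitary_diag[OF W]) (simp add: less_imp_le algebra_simps)
  ultimately show ?thesis unfolding Let_def ..
qed

end
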